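(* Let $p$ be a prime, $1\le r\le q<\infty$ and $0\le\beta<1$. For any Haar measurable function $F:\mathbb{Q}_p\times\mathbb{Q}_p\to\mathbb{C}$ such that $$\int_{\mathbb{Q}_p}\|F(y,\cdot)\|_{C^{\beta}M_{r,q}(\mathbb{Q}_p)}\,dy<\infty,$$ we have $$\left\|\int_{\mathbb{Q}_p}F(y,\cdot)\,dy\right\|_{C^{\beta}M_{r,q}(\mathbb{Q}_p)}\le\int_{\mathbb{Q}_p}\|F(y,\cdot)\|_{C^{\beta}M_{r,q}(\mathbb{Q}_p)}\,dy.$$
   Context: $\mathbb{Q}_p$ is the field of $p$-adic numbers with the $p$-adic absolute value $|\cdot|_p$, and $dx$ is the Haar measure on $(\mathbb{Q}_p,+)$ normalized so that $\{x:|x|_p\le 1\}$ has measure $1$; $|E|$ denotes the measure of $E$. For $a\in\mathbb{Q}_p$, $\ell\in\mathbb{Z}$, let $B^\ell(a)=\{x\in\mathbb{Q}_p:|x-a|_p\le p^\ell\}$, so $|B^\ell(a)|=p^\ell$. For $1\le r\le q<\infty$ and $0\le\beta<1$, the fractional Cesàro–Morrey norm of a measurable function $f$ on $\mathbb{Q}_p$ (with values in $[0,\infty]$) is $$\|f\|_{C^{\beta}M_{r,q}(\mathbb{Q}_p)}=\sup_{a\in\mathbb{Q}_p,\ \ell\in\mathbb{Z}}|B^\ell(a)|^{\frac1q-\frac1r}\left(\int_{B^\ell(a)}\left(\frac{1}{|x|_p^{1-\beta}}\int_{|t|_p\le|x|_p}|f(t)|\,dt\right)^r dx\right)^{1/r}.$$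 Here $\int_{\mathbb{Q}_p}F(y,\cdot)\,dy$ denotes the function $t\mapsto\int_{\mathbb{Q}_p}F(y,t)\,dy$. *)

theory Defs
  imports "HOL-Analysis.Analysis" "Berlekamp_Zassenhaus.Finite_Field"
begin

section \<open>The p-adic absolute value on the rationals\<close>

definition rat_padic_val :: "nat \<Rightarrow> rat \<Rightarrow> int" where
  "rat_padic_val p x =
     int (multiplicity (int p) (fst (quotient_of x))) - int (multiplicity (int p) (snd (quotient_of x)))"

definition rat_padic_abs :: "nat \<Rightarrow> rat \<Rightarrow> real" where
  "rat_padic_abs p x = (if x = 0 then 0 else real p powi (- rat_padic_val p x))"

lemma rat_padic_val_divide:
  assumes p: "prime p" and a: "a \<noteq> 0" and b: "b \<noteq> 0"
  shows "rat_padic_val p (of_int a / of_int b) =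
           int (multiplicity (int p) a) - int (multiplicity (int p) b)"
proof -
  define c where "c = fst (quotient_of (of_int a / of_int b))"
  define d where "d = snd (quotient_of (of_int a / of_int b))"
  have q: "quotient_of (of_int a / of_int b) = (c, d)"
    by (simp add: c_def d_def)
  have d: "d > 0" using quotient_of_denom_pos[OF q] .
  have eq: "(of_int a / of_int b :: rat) = of_int c / of_int d"
    using quotient_of_div[OF q] .
  have "(of_int (a * d) :: rat) = of_int (c * b)"
    using eq b d by (simp add: field_simps)
  hence ad: "a * d = c * b" by (simp only: of_int_eq_iff)
  have c: "c \<noteq> 0" using ad a d by auto
  have pp: "prime_elem (int p)" using p by simp
  have "multiplicity (int p) (a * d) = multiplicity (int p) (c * b)"
    by (simp only: ad)
  hence "multiplicity (int p) a + multiplicity (int p) d =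
        multiplicity (int p) c + multiplicity (int p) b"
    using prime_elem_multiplicity_mult_distrib[OF pp] a b c d by simp
  thus ?thesis unfolding rat_padic_val_def q by simp
qed

lemma rat_padic_abs_divide:
  assumes "prime p" and "a \<noteq> 0" and "b \<noteq> 0"
  shows "rat_padic_abs p (of_int a / of_int b) =
           real p ^ multiplicity (int p) b / real p ^ multiplicity (int p) a"
proof -
  have "real p \<noteq> 0" using prime_gt_0_nat[OF assms(1)] by simp
  thus ?thesis
    using assms rat_padic_val_divide[OF assms]
    by (simp add: rat_padic_abs_def power_int_diff)
qed

lemma rat_cases_divide:
  fixes x :: rat
  obtains a b where "x = of_int a / of_int b" "b > 0"
  using quotient_of_div[of x] quotient_of_denom_pos[of x] by (metis surj_pair)

lemma rat_padic_abs_nonneg [simp]: "0 \<le> rat_padic_abs p x"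
  by (simp add: rat_padic_abs_def)

lemma rat_padic_abs_0 [simp]: "rat_padic_abs p 0 = 0"
  by (simp add: rat_padic_abs_def)

lemma rat_padic_abs_eq_0_iff: "prime p \<Longrightarrow> rat_padic_abs p x = 0 \<longleftrightarrow> x = 0"
  using prime_gt_0_nat[of p] by (auto simp: rat_padic_abs_def)

lemma rat_padic_abs_mult:
  assumes p: "prime p"
  shows "rat_padic_abs p (x * y) = rat_padic_abs p x * rat_padic_abs p y"
proof (cases "x = 0 \<or> y = 0")
  case False
  obtain a b where x: "x = of_int a / of_int b" "b > 0" by (rule rat_cases_divide)
  obtain c d where y: "y = of_int c / of_int d" "d > 0" by (rule rat_cases_divide)
  have nz: "a \<noteq> 0" "c \<noteq> 0" "b \<noteq> 0" "d \<noteq> 0" using False x y by auto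
  have pp: "prime_elem (int p)" using p by simp
  have xy: "x * y = of_int (a * c) / of_int (b * d)" using x y by simp
  have "rat_padic_abs p (x * y) =
      real p ^ multiplicity (int p) (b * d) / real p ^ multiplicity (int p) (a * c)"
    unfolding xy by (rule rat_padic_abs_divide[OF p]) (use nz in auto)
  also have "\<dots> = rat_padic_abs p x * rat_padic_abs p y"
    unfolding x y using nz rat_padic_abs_divide[OF p]
    by (simp add: prime_elem_multiplicity_mult_distrib[OF pp] power_add)
  finally show ?thesis .
qed auto

lemma rat_padic_abs_minus [simp]:
  assumes p: "prime p"
  shows "rat_padic_abs p (- x) = rat_padic_abs p x"
proof -
  have "rat_padic_abs p (- 1) = 1"
    using rat_padic_abs_divide[OF p, of "-1" 1] by (simp add: multiplicity_unit_right)
  thus ?thesis using rat_padic_abs_mult[OF p, of "-1" x] by simp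
qed

lemma rat_padic_abs_1 [simp]: "prime p \<Longrightarrow> rat_padic_abs p 1 = 1"
  using rat_padic_abs_divide[of p 1 1] by simp

lemma rat_padic_abs_inverse:
  assumes p: "prime p"
  shows "rat_padic_abs p (inverse x) = inverse (rat_padic_abs p x)"
proof (cases "x = 0")
  case False
  have "rat_padic_abs p x * rat_padic_abs p (inverse x) = 1"
    using rat_padic_abs_mult[OF p, of x "inverse x"] False p by simp
  thus ?thesis by (metis inverse_unique)
qed simp

lemma rat_padic_abs_add:
  assumes p: "prime p"
  shows "rat_padic_abs p (x + y) \<le> max (rat_padic_abs p x) (rat_padic_abs p y)"
proof (cases "x = 0 \<or> y = 0 \<or> x + y = 0")
  case True
  thus ?thesis by (auto simp: le_max_iff_disj)
next
  case False
  obtain a b where x: "x = of_int a / of_int b" "b > 0" by (rule rat_cases_divide)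
  obtain c d where y: "y = of_int c / of_int d" "d > 0" by (rule rat_cases_divide)
  define m where "m = multiplicity (int p)"
  define u v w where "u = a * d" and "v = c * b" and "w = b * d"
  have nz: "u \<noteq> 0" "v \<noteq> 0" "w \<noteq> 0" using False x y by (auto simp: u_def v_def w_def)
  have xu: "x = of_int u / of_int w" and yv: "y = of_int v / of_int w"
    using x y by (auto simp: u_def v_def w_def)
  have xy: "x + y = of_int (u + v) / of_int w"
    by (simp add: xu yv add_divide_distrib)
  have uv: "u + v \<noteq> 0" using False xy by auto
  have pr: "prime (int p)" using p by simp
  have "int p ^ min (m u) (m v) dvd u + v"
    by (intro dvd_add) (auto simp: m_def intro!: multiplicity_dvd')
  hence le: "min (m u) (m v) \<le> m (u + v)"
    unfolding m_def using pr uv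
    by (intro multiplicity_geI) auto
  have p1: "real p > 1" using prime_gt_1_nat[OF p] by simp
  have "rat_padic_abs p (x + y) = real p ^ m w / real p ^ m (u + v)"
    unfolding xy m_def by (rule rat_padic_abs_divide[OF p]) (use nz uv in auto)
  also have "\<dots> \<le> real p ^ m w / real p ^ min (m u) (m v)"
    using p1 le by (intro divide_left_mono) (auto intro!: power_increasing)
  also have "\<dots> \<le> max (rat_padic_abs p x) (rat_padic_abs p y)"
    unfolding xu yv using rat_padic_abs_divide[OF p] nz by (simp add: m_def min_def max_def)
  finally show ?thesis .
qed

lemma rat_padic_abs_triangle:
  assumes p: "prime p"
  shows "rat_padic_abs p (x + y) \<le> rat_padic_abs p x + rat_padic_abs p y"
  using rat_padic_abs_add[OF p, of x y] rat_padic_abs_nonneg[of p x] rat_padic_abs_nonneg[of p y]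
  by linarith

lemma rat_padic_abs_diff_commute:
  "prime p \<Longrightarrow> rat_padic_abs p (x - y) = rat_padic_abs p (y - x)"
  by (metis minus_diff_eq rat_padic_abs_minus)

lemma rat_padic_abs_diff_triangle:
  "prime p \<Longrightarrow> rat_padic_abs p (x - z) \<le> rat_padic_abs p (x - y) + rat_padic_abs p (y - z)"
  using rat_padic_abs_triangle[of p "x - y" "y - z"] by simp

lemma rat_padic_abs_reverse_triangle:
  assumes p: "prime p"
  shows "\<bar>rat_padic_abs p x - rat_padic_abs p y\<bar> \<le> rat_padic_abs p (x - y)"
  using rat_padic_abs_triangle[OF p, of "x - y" y] rat_padic_abs_triangle[OF p, of "y - x" x]
    rat_padic_abs_diff_commute[OF p, of x y] by simp


section \<open>Cauchy sequences\<close>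

definition padic_cauchy :: "nat \<Rightarrow> (nat \<Rightarrow> rat) \<Rightarrow> bool" where
  "padic_cauchy p X \<longleftrightarrow> (\<forall>e>0. \<exists>M. \<forall>m\<ge>M. \<forall>n\<ge>M. rat_padic_abs p (X m - X n) < e)"

definition padic_vanishes :: "nat \<Rightarrow> (nat \<Rightarrow> rat) \<Rightarrow> bool" where
  "padic_vanishes p X \<longleftrightarrow> (\<lambda>n. rat_padic_abs p (X n)) \<longlonglongrightarrow> 0"

lemma padic_cauchy_const [simp]: "padic_cauchy p (\<lambda>n. c)"
  by (simp add: padic_cauchy_def)

lemma padic_vanishes_0 [simp]: "padic_vanishes p (\<lambda>n. 0)"
  by (simp add: padic_vanishes_def)

lemma padic_vanishes_le:
  assumes "padic_vanishes p X" "eventually (\<lambda>n. rat_padic_abs p (Y n) \<le> C * rat_padic_abs p (X n)) sequentially"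
  shows "padic_vanishes p Y"
  unfolding padic_vanishes_def
proof (rule tendsto_sandwich[OF _ assms(2), where f = "\<lambda>_. 0"])
  show "(\<lambda>n. C * rat_padic_abs p (X n)) \<longlonglongrightarrow> 0"
    using tendsto_mult_right_zero assms(1) unfolding padic_vanishes_def by blast
qed auto

context
  fixes p :: nat
  assumes p: "prime p"
begin

lemma padic_vanishes_minus: "padic_vanishes p (\<lambda>n. - X n) \<longleftrightarrow> padic_vanishes p X"
  using p by (simp add: padic_vanishes_def)

lemma padic_vanishes_add:
  assumes "padic_vanishes p X" "padic_vanishes p Y"
  shows "padic_vanishes p (\<lambda>n. X n + Y n)"
  unfolding padic_vanishes_def
proof (rule tendsto_sandwich[where f = "\<lambda>_. 0"])
  show "(\<lambda>n. rat_padic_abs p (X n) + rat_padic_abs p (Y n)) \<longlonglongrightarrow> 0"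
    using tendsto_add[of _ 0 _ _ 0] assms unfolding padic_vanishes_def by fastforce
qed (auto simp: rat_padic_abs_triangle[OF p])

lemma padic_vanishes_diff:
  assumes "padic_vanishes p X" "padic_vanishes p Y"
  shows "padic_vanishes p (\<lambda>n. X n - Y n)"
  using padic_vanishes_add[of X "\<lambda>n. - Y n"] assms by (simp add: padic_vanishes_minus)

lemma padic_cauchy_convergent_abs:
  assumes "padic_cauchy p X"
  shows "convergent (\<lambda>n. rat_padic_abs p (X n))"
proof -
  have "Cauchy (\<lambda>n. rat_padic_abs p (X n))"
    unfolding Cauchy_def dist_real_def
  proof (intro allI impI)
    fix e :: real assume "e > 0"
    then obtain M where "\<forall>m\<ge>M. \<forall>n\<ge>M. rat_padic_abs p (X m - X n) < e"
      using assms unfolding padic_cauchy_def by blast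
    thus "\<exists>M. \<forall>m\<ge>M. \<forall>n\<ge>M. \<bar>rat_padic_abs p (X m) - rat_padic_abs p (X n)\<bar> < e"
      using rat_padic_abs_reverse_triangle[OF p] by (meson le_less_trans)
  qed
  thus ?thesis by (rule Cauchy_convergent)
qed

lemma padic_cauchy_bounded:
  assumes "padic_cauchy p X"
  obtains C where "C > 0" "\<And>n. rat_padic_abs p (X n) \<le> C"
proof -
  have "Bseq (\<lambda>n. rat_padic_abs p (X n))"
    using padic_cauchy_convergent_abs[OF assms] by (rule convergent_imp_Bseq)
  then obtain C where "C > 0" "\<forall>n. norm (rat_padic_abs p (X n)) \<le> C" by (rule BseqE)
  thus ?thesis using that[of C] by simp
qed

lemma padic_cauchy_not_vanishes:
  assumes X: "padic_cauchy p X" and nv: "\<not> padic_vanishes p X"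
  obtains c where "c > 0" "eventually (\<lambda>n. rat_padic_abs p (X n) > c) sequentially"
proof -
  obtain L where L: "(\<lambda>n. rat_padic_abs p (X n)) \<longlonglongrightarrow> L"
    using padic_cauchy_convergent_abs[OF X] unfolding convergent_def by blast
  have "L \<ge> 0" by (rule LIMSEQ_le_const[OF L]) auto
  moreover have "L \<noteq> 0" using L nv unfolding padic_vanishes_def by auto
  ultimately have "L / 2 > 0" "L / 2 < L" by auto
  thus ?thesis using that[of "L / 2"] order_tendstoD(1)[OF L] by blast
qed

lemma padic_cauchy_add:
  assumes X: "padic_cauchy p X" and Y: "padic_cauchy p Y"
  shows "padic_cauchy p (\<lambda>n. X n + Y n)"
  unfolding padic_cauchy_def
proof (intro allI impI)
  fix e :: real assume e: "e > 0"
  obtain M where M: "\<forall>m\<ge>M. \<forall>n\<ge>M. rat_padic_abs p (X m - X n) < e"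
    using X e unfolding padic_cauchy_def by blast
  obtain N where N: "\<forall>m\<ge>N. \<forall>n\<ge>N. rat_padic_abs p (Y m - Y n) < e"
    using Y e unfolding padic_cauchy_def by blast
  have "rat_padic_abs p (X m + Y m - (X n + Y n)) < e" if "m \<ge> max M N" "n \<ge> max M N" for m n
    using rat_padic_abs_add[OF p, of "X m - X n" "Y m - Y n"] M[rule_format, of m n] N[rule_format, of m n] that
    by (simp add: algebra_simps)
  thus "\<exists>K. \<forall>m\<ge>K. \<forall>n\<ge>K. rat_padic_abs p (X m + Y m - (X n + Y n)) < e" by blast
qed

lemma padic_cauchy_minus:
  assumes X: "padic_cauchy p X"
  shows "padic_cauchy p (\<lambda>n. - X n)"
proof -
  have "rat_padic_abs p (- X m - (- X n)) = rat_padic_abs p (X m - X n)" for m n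
    using rat_padic_abs_diff_commute[OF p, of "X m" "X n"] by simp
  thus ?thesis using X unfolding padic_cauchy_def by simp
qed

lemma padic_cauchy_mult:
  assumes X: "padic_cauchy p X" and Y: "padic_cauchy p Y"
  shows "padic_cauchy p (\<lambda>n. X n * Y n)"
  unfolding padic_cauchy_def
proof (intro allI impI)
  fix e :: real assume e: "e > 0"
  obtain C where C: "C > 0" "\<And>n. rat_padic_abs p (X n) \<le> C" using padic_cauchy_bounded[OF X] by blast
  obtain D where D: "D > 0" "\<And>n. rat_padic_abs p (Y n) \<le> D" using padic_cauchy_bounded[OF Y] by blast
  obtain M where M: "\<forall>m\<ge>M. \<forall>n\<ge>M. rat_padic_abs p (X m - X n) < e / D"
    using X e D unfolding padic_cauchy_def by (meson divide_pos_pos)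
  obtain N where N: "\<forall>m\<ge>N. \<forall>n\<ge>N. rat_padic_abs p (Y m - Y n) < e / C"
    using Y e C unfolding padic_cauchy_def by (meson divide_pos_pos)
  have "rat_padic_abs p (X m * Y m - X n * Y n) < e" if mn: "m \<ge> max M N" "n \<ge> max M N" for m n
  proof -
    have "rat_padic_abs p (X m * (Y m - Y n)) \<le> C * rat_padic_abs p (Y m - Y n)"
      using C by (simp add: rat_padic_abs_mult[OF p] mult_right_mono)
    also have "\<dots> < C * (e / C)" using N mn C by (intro mult_strict_left_mono) auto
    finally have 1: "rat_padic_abs p (X m * (Y m - Y n)) < e" using C by simp
    have "rat_padic_abs p ((X m - X n) * Y n) \<le> rat_padic_abs p (X m - X n) * D"
      using D by (simp add: rat_padic_abs_mult[OF p] mult_left_mono)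
    also have "\<dots> < (e / D) * D" using M mn D by (intro mult_strict_right_mono) auto
    finally have 2: "rat_padic_abs p ((X m - X n) * Y n) < e" using D by simp
    have "X m * Y m - X n * Y n = X m * (Y m - Y n) + (X m - X n) * Y n"
      by (simp add: algebra_simps)
    thus ?thesis using 1 2 rat_padic_abs_add[OF p, of "X m * (Y m - Y n)" "(X m - X n) * Y n"] by simp
  qed
  thus "\<exists>K. \<forall>m\<ge>K. \<forall>n\<ge>K. rat_padic_abs p (X m * Y m - X n * Y n) < e" by blast
qed

lemma padic_vanishes_mult:
  assumes "padic_cauchy p X" "padic_vanishes p Y"
  shows "padic_vanishes p (\<lambda>n. X n * Y n)"
proof -
  obtain C where "C > 0" "\<And>n. rat_padic_abs p (X n) \<le> C" using padic_cauchy_bounded[OF assms(1)] by blast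
  thus ?thesis
    by (intro padic_vanishes_le[OF assms(2), of _ C])
       (auto simp: rat_padic_abs_mult[OF p] mult_right_mono)
qed

lemma rat_padic_abs_inverse_diff_le:
  assumes c: "c > 0" and x: "rat_padic_abs p x > c" and y: "rat_padic_abs p y > c"
  shows "rat_padic_abs p (inverse x - inverse y) \<le> inverse (c * c) * rat_padic_abs p (x - y)"
proof -
  have nz: "x \<noteq> 0" "y \<noteq> 0" using assms by auto
  have "rat_padic_abs p (inverse x - inverse y) =
      inverse (rat_padic_abs p x) * rat_padic_abs p (x - y) * inverse (rat_padic_abs p y)"
    using nz by (simp add: inverse_diff_inverse rat_padic_abs_mult[OF p] rat_padic_abs_inverse[OF p] p)
  also have "\<dots> \<le> inverse c * rat_padic_abs p (x - y) * inverse c"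
    using assms by (intro mult_mono le_imp_inverse_le) auto
  finally show ?thesis by (simp add: mult_ac)
qed

lemma padic_cauchy_inverse:
  assumes X: "padic_cauchy p X" and nv: "\<not> padic_vanishes p X"
  shows "padic_cauchy p (\<lambda>n. inverse (X n))"
  unfolding padic_cauchy_def
proof (intro allI impI)
  fix e :: real assume e: "e > 0"
  obtain c where c: "c > 0" "eventually (\<lambda>n. rat_padic_abs p (X n) > c) sequentially"
    using padic_cauchy_not_vanishes[OF X nv] by blast
  then obtain N where N: "\<forall>n\<ge>N. rat_padic_abs p (X n) > c"
    by (auto simp: eventually_sequentially)
  have "e * (c * c) > 0" using e c by simp
  then obtain M where M: "\<forall>m\<ge>M. \<forall>n\<ge>M. rat_padic_abs p (X m - X n) < e * (c * c)"
    using X unfolding padic_cauchy_def by blast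
  have "rat_padic_abs p (inverse (X m) - inverse (X n)) < e" if mn: "m \<ge> max M N" "n \<ge> max M N" for m n
  proof -
    have "rat_padic_abs p (inverse (X m) - inverse (X n)) \<le> inverse (c * c) * rat_padic_abs p (X m - X n)"
      using N mn by (intro rat_padic_abs_inverse_diff_le c) auto
    also have "\<dots> < inverse (c * c) * (e * (c * c))"
      using M mn c by (intro mult_strict_left_mono) auto
    finally show ?thesis using c by (simp add: field_simps)
  qed
  thus "\<exists>K. \<forall>m\<ge>K. \<forall>n\<ge>K. rat_padic_abs p (inverse (X m) - inverse (X n)) < e" by blast
qed

lemma padic_vanishes_diff_inverse:
  assumes X: "padic_cauchy p X" "\<not> padic_vanishes p X"
    and Y: "padic_cauchy p Y" "\<not> padic_vanishes p Y"
    and XY: "padic_vanishes p (\<lambda>n. X n - Y n)"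
  shows "padic_vanishes p (\<lambda>n. inverse (X n) - inverse (Y n))"
proof -
  obtain c where c: "c > 0" "eventually (\<lambda>n. rat_padic_abs p (X n) > c) sequentially"
    using padic_cauchy_not_vanishes[OF X] by blast
  obtain d where d: "d > 0" "eventually (\<lambda>n. rat_padic_abs p (Y n) > d) sequentially"
    using padic_cauchy_not_vanishes[OF Y] by blast
  define b where "b = min c d"
  have b: "b > 0" using c d by (simp add: b_def)
  show ?thesis
  proof (rule padic_vanishes_le[OF XY, of _ "inverse (b * b)"])
    show "eventually (\<lambda>n. rat_padic_abs p (inverse (X n) - inverse (Y n))
            \<le> inverse (b * b) * rat_padic_abs p (X n - Y n)) sequentially"
      using c(2) d(2)
      by eventually_elim (rule rat_padic_abs_inverse_diff_le[OF b], auto simp: b_def)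
  qed
qed

end


section \<open>The field of p-adic numbers\<close>

text \<open>
  The prime is the cardinality \<^term>\<open>CARD('p)\<close> of a type \<^typ>\<open>'p\<close> of class
  \<^class>\<open>prime_card\<close>; \<^typ>\<open>'p\<close> plays no other role.
\<close>

typedef (overloaded) 'p padic_seq = "{X. padic_cauchy CARD('p::prime_card) X}"
  by (rule exI[of _ "\<lambda>n. 0"]) simp

setup_lifting type_definition_padic_seq

instantiation padic_seq :: (prime_card) comm_ring_1
begin

lift_definition zero_padic_seq :: "'a padic_seq" is "\<lambda>n. 0"
  by simp

lift_definition one_padic_seq :: "'a padic_seq" is "\<lambda>n. 1"
  by simp

lift_definition plus_padic_seq :: "'a padic_seq \<Rightarrow> 'a padic_seq \<Rightarrow> 'a padic_seq" is "\<lambda>X Y n. X n + Y n"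
  by (rule padic_cauchy_add[OF prime_card])

lift_definition uminus_padic_seq :: "'a padic_seq \<Rightarrow> 'a padic_seq" is "\<lambda>X n. - X n"
  by (rule padic_cauchy_minus[OF prime_card])

lift_definition minus_padic_seq :: "'a padic_seq \<Rightarrow> 'a padic_seq \<Rightarrow> 'a padic_seq" is "\<lambda>X Y n. X n - Y n"
  using padic_cauchy_add[OF prime_card] padic_cauchy_minus[OF prime_card] by fastforce

lift_definition times_padic_seq :: "'a padic_seq \<Rightarrow> 'a padic_seq \<Rightarrow> 'a padic_seq" is "\<lambda>X Y n. X n * Y n"
  by (rule padic_cauchy_mult[OF prime_card])

instance
  by standard (transfer; simp add: fun_eq_iff algebra_simps)+

end

lift_definition padic_seq_null :: "'p::prime_card padic_seq \<Rightarrow> bool" is "padic_vanishes CARD('p)" .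

lift_definition padic_seq_inverse :: "'p::prime_card padic_seq \<Rightarrow> 'p padic_seq" is
  "\<lambda>X. if padic_vanishes CARD('p) X then (\<lambda>n. 0) else (\<lambda>n. inverse (X n))"
  by (simp add: padic_cauchy_inverse[OF prime_card])

lift_definition padic_seq_abs :: "'p::prime_card padic_seq \<Rightarrow> real" is
  "\<lambda>X. lim (\<lambda>n. rat_padic_abs CARD('p) (X n))" .

lift_definition padic_seq_const :: "rat \<Rightarrow> 'p::prime_card padic_seq" is "\<lambda>q n. q"
  by simp

lemma padic_seq_null_0 [simp]: "padic_seq_null 0"
  by transfer simp

lemma padic_seq_null_minus [simp]: "padic_seq_null (- x) \<longleftrightarrow> padic_seq_null x"
  by transfer (rule padic_vanishes_minus[OF prime_card])

lemma padic_seq_null_add: "padic_seq_null x \<Longrightarrow> padic_seq_null y \<Longrightarrow> padic_seq_null (x + y)"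
  by transfer (rule padic_vanishes_add[OF prime_card])

lemma padic_seq_null_mult: "padic_seq_null y \<Longrightarrow> padic_seq_null (x * y)"
  by transfer (rule padic_vanishes_mult[OF prime_card])

lemma padic_seq_null_diff_commute: "padic_seq_null (x - y) \<longleftrightarrow> padic_seq_null (y - x)"
  using padic_seq_null_minus[of "x - y"] by simp

lemma padic_seq_null_cong: "padic_seq_null (x - y) \<Longrightarrow> padic_seq_null x \<longleftrightarrow> padic_seq_null y"
  using padic_seq_null_add[of "x - y" y] padic_seq_null_add[of "y - x" x]
    padic_seq_null_diff_commute[of x y] by auto

lemma padic_seq_inverse_cong:
  assumes "padic_seq_null (x - y)"
  shows "padic_seq_null (padic_seq_inverse x - padic_seq_inverse y)"
  using assms padic_seq_null_cong[OF assms]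
  by transfer (auto intro!: padic_vanishes_diff_inverse[OF prime_card])

lemma padic_seq_inverse_mult:
  assumes "\<not> padic_seq_null x"
  shows "padic_seq_null (padic_seq_inverse x * x - 1)"
  using assms
proof transfer
  fix X :: "nat \<Rightarrow> rat"
  assume X: "padic_cauchy CARD('a) X" "\<not> padic_vanishes CARD('a) X"
  obtain c where c: "c > 0" "eventually (\<lambda>n. rat_padic_abs CARD('a) (X n) > c) sequentially"
    using padic_cauchy_not_vanishes[OF prime_card X] by blast
  have "eventually (\<lambda>n. rat_padic_abs CARD('a) (inverse (X n) * X n - 1) = 0) sequentially"
    using c(2)
  proof eventually_elim
    case (elim n)
    hence "X n \<noteq> 0" using c(1) by auto
    thus ?case by simp
  qed
  thus "padic_vanishes CARD('a)
      (\<lambda>n. (if padic_vanishes CARD('a) X then \<lambda>n. 0 else (\<lambda>n. inverse (X n))) n * X n - 1)"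
    using X(2) unfolding padic_vanishes_def by (simp add: tendsto_eventually)
qed

lemma padic_seq_abs_LIMSEQ:
  "(\<lambda>n. rat_padic_abs CARD('p::prime_card) (Rep_padic_seq x n)) \<longlonglongrightarrow> padic_seq_abs (x :: 'p padic_seq)"
  by transfer (use padic_cauchy_convergent_abs[OF prime_card] convergent_LIMSEQ_iff in blast)

lemma padic_seq_abs_cong:
  fixes x y :: "'p::prime_card padic_seq"
  assumes "padic_seq_null (x - y)"
  shows "padic_seq_abs x = padic_seq_abs y"
proof -
  let ?a = "rat_padic_abs CARD('p)"
  have "(\<lambda>n. ?a (Rep_padic_seq x n) - ?a (Rep_padic_seq y n)) \<longlonglongrightarrow> padic_seq_abs x - padic_seq_abs y"
    by (intro tendsto_diff padic_seq_abs_LIMSEQ)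
  moreover have "(\<lambda>n. ?a (Rep_padic_seq x n) - ?a (Rep_padic_seq y n)) \<longlonglongrightarrow> 0"
  proof (rule tendsto_rabs_zero_cancel, rule tendsto_sandwich[where f = "\<lambda>_. 0"])
    show "(\<lambda>n. ?a (Rep_padic_seq x n - Rep_padic_seq y n)) \<longlonglongrightarrow> 0"
      using assms by transfer (simp add: padic_vanishes_def)
  qed (auto simp: rat_padic_abs_reverse_triangle[OF prime_card])
  ultimately show ?thesis using LIMSEQ_unique by fastforce
qed

quotient_type (overloaded) 'p padic = "'p::prime_card padic_seq" / "\<lambda>x y. padic_seq_null (x - y)"
proof (rule equivpI)
  show "reflp (\<lambda>x y :: 'p padic_seq. padic_seq_null (x - y))"
    by (rule reflpI) simp
  show "symp (\<lambda>x y :: 'p padic_seq. padic_seq_null (x - y))"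
    by (rule sympI) (simp add: padic_seq_null_diff_commute)
  show "transp (\<lambda>x y :: 'p padic_seq. padic_seq_null (x - y))"
  proof (rule transpI)
    fix x y z :: "'p padic_seq"
    assume "padic_seq_null (x - y)" "padic_seq_null (y - z)"
    thus "padic_seq_null (x - z)" using padic_seq_null_add[of "x - y" "y - z"] by simp
  qed
qed

instantiation padic :: (prime_card) field
begin

lift_definition zero_padic :: "'a padic" is 0 .

lift_definition one_padic :: "'a padic" is 1 .

lift_definition plus_padic :: "'a padic \<Rightarrow> 'a padic \<Rightarrow> 'a padic" is "(+)"
  subgoal for a b c d
    using padic_seq_null_add[of "a - b" "c - d"] by (simp add: algebra_simps)
  done

lift_definition uminus_padic :: "'a padic \<Rightarrow> 'a padic" is uminus
  by (simp add: padic_seq_null_diff_commute)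

lift_definition minus_padic :: "'a padic \<Rightarrow> 'a padic \<Rightarrow> 'a padic" is "(-)"
  subgoal for a b c d
    using padic_seq_null_add[of "a - b" "d - c"] padic_seq_null_diff_commute[of c d]
    by (simp add: algebra_simps)
  done

lift_definition times_padic :: "'a padic \<Rightarrow> 'a padic \<Rightarrow> 'a padic" is "(*)"
  subgoal for a b c d
    using padic_seq_null_add[OF padic_seq_null_mult[of "a - b" c] padic_seq_null_mult[of "c - d" b]]
    by (simp add: algebra_simps)
  done

lift_definition inverse_padic :: "'a padic \<Rightarrow> 'a padic" is padic_seq_inverse
  by (rule padic_seq_inverse_cong)

definition divide_padic :: "'a padic \<Rightarrow> 'a padic \<Rightarrow> 'a padic" where
  "divide_padic x y = x * inverse y"

instance
proof
  fix a b c :: "'a padic"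
  show "a * b * c = a * (b * c)" by transfer (simp add: mult_ac)
  show "a * b = b * a" by transfer (simp add: mult_ac)
  show "1 * a = a" by transfer simp
  show "a + b + c = a + (b + c)" by transfer (simp add: add_ac)
  show "a + b = b + a" by transfer (simp add: add_ac)
  show "0 + a = a" by transfer simp
  show "- a + a = 0" by transfer simp
  show "a - b = a + - b" by transfer simp
  show "(a + b) * c = a * c + b * c" by transfer (simp add: algebra_simps)
  show "(0 :: 'a padic) \<noteq> 1"
    by transfer (transfer, simp add: padic_vanishes_def prime_card LIMSEQ_const_iff)
  show "a \<noteq> 0 \<Longrightarrow> inverse a * a = 1"
    by transfer (simp add: padic_seq_inverse_mult)
  show "a div b = a * inverse b" by (rule divide_padic_def)
  show "inverse (0 :: 'a padic) = 0" by transfer (transfer, simp)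
qed

end

lift_definition padic_abs :: "'p::prime_card padic \<Rightarrow> real" is padic_seq_abs
  by (rule padic_seq_abs_cong)

lemma padic_abs_nonneg [simp]: "0 \<le> padic_abs (x :: 'p::prime_card padic)"
proof transfer
  show "0 \<le> padic_seq_abs (x :: 'p padic_seq)" for x
    using padic_seq_abs_LIMSEQ[of x] by (rule LIMSEQ_le_const) auto
qed

lemma padic_abs_eq_0_iff [simp]:
  fixes x :: "'p::prime_card padic"
  shows "padic_abs x = 0 \<longleftrightarrow> x = 0"
proof transfer
  show "padic_seq_abs x = 0 \<longleftrightarrow> padic_seq_null (x - 0)" for x :: "'p padic_seq"
  proof -
    have "padic_seq_null x \<longleftrightarrow> (\<lambda>n. rat_padic_abs CARD('p) (Rep_padic_seq x n)) \<longlonglongrightarrow> 0"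
      by transfer (simp add: padic_vanishes_def)
    thus ?thesis using padic_seq_abs_LIMSEQ[of x] by (auto dest: LIMSEQ_unique)
  qed
qed

lemma padic_abs_0 [simp]: "padic_abs 0 = 0"
  by simp

lemma padic_abs_mult:
  fixes x y :: "'p::prime_card padic"
  shows "padic_abs (x * y) = padic_abs x * padic_abs y"
proof transfer
  fix x y :: "'p padic_seq"
  have "(\<lambda>n. rat_padic_abs CARD('p) (Rep_padic_seq (x * y) n)) \<longlonglongrightarrow> padic_seq_abs x * padic_seq_abs y"
    unfolding times_padic_seq.rep_eq rat_padic_abs_mult[OF prime_card]
    by (intro tendsto_mult padic_seq_abs_LIMSEQ)
  thus "padic_seq_abs (x * y) = padic_seq_abs x * padic_seq_abs y"
    using padic_seq_abs_LIMSEQ[of "x * y"] LIMSEQ_unique by blast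
qed

lemma padic_abs_add:
  fixes x y :: "'p::prime_card padic"
  shows "padic_abs (x + y) \<le> max (padic_abs x) (padic_abs y)"
proof transfer
  fix x y :: "'p padic_seq"
  have "(\<lambda>n. max (rat_padic_abs CARD('p) (Rep_padic_seq x n)) (rat_padic_abs CARD('p) (Rep_padic_seq y n)))
          \<longlonglongrightarrow> max (padic_seq_abs x) (padic_seq_abs y)"
    by (intro tendsto_max padic_seq_abs_LIMSEQ)
  thus "padic_seq_abs (x + y) \<le> max (padic_seq_abs x) (padic_seq_abs y)"
    by (intro LIMSEQ_le[OF padic_seq_abs_LIMSEQ[of "x + y"]])
       (auto simp: plus_padic_seq.rep_eq rat_padic_abs_add[OF prime_card])
qed

lemma padic_abs_minus [simp]:
  fixes x :: "'p::prime_card padic"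
  shows "padic_abs (- x) = padic_abs x"
proof transfer
  show "padic_seq_abs (- x) = padic_seq_abs x" for x :: "'p padic_seq"
    using padic_seq_abs_LIMSEQ[of "- x"] padic_seq_abs_LIMSEQ[of x]
    by (auto simp: uminus_padic_seq.rep_eq prime_card dest: LIMSEQ_unique)
qed

lemma padic_abs_diff_commute: "padic_abs (x - y) = padic_abs (y - x)"
  using padic_abs_minus[of "x - y"] by simp

lemma padic_of_nat: "of_nat n = abs_padic (padic_seq_const (of_nat n) :: 'p::prime_card padic_seq)"
proof (induction n)
  case 0
  have "0 = (padic_seq_const 0 :: 'p padic_seq)" by transfer simp
  thus ?case by (simp add: zero_padic.abs_eq)
next
  case (Suc n)
  have "1 + padic_seq_const (of_nat n) = (padic_seq_const (of_nat (Suc n)) :: 'p padic_seq)"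
    by transfer simp
  thus ?case using Suc by (simp add: one_padic.abs_eq plus_padic.abs_eq)
qed

lemma padic_abs_const: "padic_abs (abs_padic (padic_seq_const q :: 'p::prime_card padic_seq)) = rat_padic_abs CARD('p) q"
  unfolding padic_abs.abs_eq by transfer (simp add: limI)

instance padic :: (prime_card) field_char_0
proof
  have "padic_abs (of_nat n :: 'a padic) \<noteq> 0" if "n \<noteq> 0" for n
    using that by (simp add: padic_of_nat padic_abs_const rat_padic_abs_eq_0_iff[OF prime_card]
        del: padic_abs_eq_0_iff)
  hence nz: "(of_nat n :: 'a padic) \<noteq> 0" if "n \<noteq> 0" for n
    using that by fastforce
  show "inj (of_nat :: nat \<Rightarrow> 'a padic)"
  proof (rule injI)
    fix m n assume eq: "(of_nat m :: 'a padic) = of_nat n"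
    show "m = n"
    proof (rule ccontr)
      assume "m \<noteq> n"
      hence "of_nat (max m n - min m n) \<noteq> (0 :: 'a padic)"
        by (intro nz) (auto simp: max_def min_def)
      thus False using eq by (auto simp: of_nat_diff max_def min_def split: if_splits)
    qed
  qed
qed

lemma padic_of_rat: "of_rat q = abs_padic (padic_seq_const q :: 'p::prime_card padic_seq)"
proof -
  have add: "abs_padic (padic_seq_const (a + b)) = abs_padic (padic_seq_const a) + (abs_padic (padic_seq_const b) :: 'p padic)" for a b
    unfolding plus_padic.abs_eq by (rule arg_cong[of _ _ abs_padic], transfer, simp)
  have minus: "abs_padic (padic_seq_const (- a)) = - (abs_padic (padic_seq_const a) :: 'p padic)" for a
    unfolding uminus_padic.abs_eq by (rule arg_cong[of _ _ abs_padic], transfer, simp)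
  have mult: "abs_padic (padic_seq_const (a * b)) = abs_padic (padic_seq_const a) * (abs_padic (padic_seq_const b) :: 'p padic)" for a b
    unfolding times_padic.abs_eq by (rule arg_cong[of _ _ abs_padic], transfer, simp)
  have int: "abs_padic (padic_seq_const (of_int k)) = (of_int k :: 'p padic)" for k
    by (cases k rule: int_cases2) (simp_all add: padic_of_nat minus)
  obtain a b where q: "q = of_int a / of_int b" "b > 0" by (rule rat_cases_divide)
  have "abs_padic (padic_seq_const (q * of_int b)) = abs_padic (padic_seq_const q) * (of_int b :: 'p padic)"
    by (simp add: mult int)
  moreover have "q * of_int b = of_int a" using q by simp
  ultimately have "abs_padic (padic_seq_const q) * (of_int b :: 'p padic) = of_int a"
    by (simp add: int)
  moreover have "(of_rat q :: 'p padic) * of_int b = of_int a"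
    using q by (simp add: of_rat_divide)
  moreover have "(of_int b :: 'p padic) \<noteq> 0" using q(2) by simp
  ultimately show ?thesis by (metis mult_right_cancel)
qed

lemma padic_abs_of_rat: "padic_abs (of_rat q :: 'p::prime_card padic) = rat_padic_abs CARD('p) q"
  by (simp add: padic_of_rat padic_abs_const)

instantiation padic :: (prime_card) metric_space
begin

definition dist_padic :: "'a padic \<Rightarrow> 'a padic \<Rightarrow> real" where
  "dist_padic x y = padic_abs (x - y)"

definition uniformity_padic :: "('a padic \<times> 'a padic) filter" where
  "uniformity_padic = (INF e\<in>{0<..}. principal {(x, y). dist x y < e})"

definition open_padic :: "'a padic set \<Rightarrow> bool" where
  "open_padic U \<longleftrightarrow> (\<forall>x\<in>U. \<forall>\<^sub>F (x', y) in uniformity. x' = x \<longrightarrow> y \<in> U)"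

instance
proof
  fix x y z :: "'a padic"
  show "dist x y = 0 \<longleftrightarrow> x = y" by (simp add: dist_padic_def)
  have "dist x y \<le> max (padic_abs (x - z)) (padic_abs (z - y))"
    using padic_abs_add[of "x - z" "z - y"] by (simp add: dist_padic_def)
  also have "\<dots> \<le> padic_abs (x - z) + padic_abs (z - y)" by simp
  finally show "dist x y \<le> dist x z + dist y z"
    by (simp add: dist_padic_def padic_abs_diff_commute)
qed (simp_all add: uniformity_padic_def open_padic_def)

end

lemma padic_rat_dense:
  fixes x :: "'p::prime_card padic"
  assumes "e > 0"
  obtains q where "padic_abs (x - of_rat q) < e"
proof -
  obtain X where X: "x = abs_padic X" by (metis Quotient3_padic Quotient3_def)
  have "padic_cauchy CARD('p) (Rep_padic_seq X)" using Rep_padic_seq by auto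
  then obtain M where M: "\<forall>m\<ge>M. \<forall>n\<ge>M. rat_padic_abs CARD('p) (Rep_padic_seq X m - Rep_padic_seq X n) < e / 2"
    using assms unfolding padic_cauchy_def by (meson half_gt_zero)
  have "padic_seq_abs (X - padic_seq_const (Rep_padic_seq X M)) \<le> e / 2"
    by (rule LIMSEQ_le_const2[OF padic_seq_abs_LIMSEQ])
       (use M in \<open>auto simp: minus_padic_seq.rep_eq padic_seq_const.rep_eq intro!: exI[of _ M] less_imp_le\<close>)
  hence "padic_abs (x - of_rat (Rep_padic_seq X M)) \<le> e / 2"
    by (simp add: X padic_of_rat minus_padic.abs_eq padic_abs.abs_eq)
  thus ?thesis using that[of "Rep_padic_seq X M"] assms by linarith
qed

instance padic :: (prime_card) complete_space
proof
  fix x :: "nat \<Rightarrow> 'a padic"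
  assume x: "Cauchy x"
  have "\<exists>q. padic_abs (x n - of_rat q) < inverse (real (Suc n))" for n
    by (rule padic_rat_dense[of "inverse (real (Suc n))" "x n"]) auto
  then obtain q where q: "\<And>n. padic_abs (x n - of_rat (q n)) < inverse (real (Suc n))" by metis
  have q0: "(\<lambda>n. dist (x n) (of_rat (q n))) \<longlonglongrightarrow> 0"
    by (rule tendsto_sandwich[OF _ _ _ LIMSEQ_inverse_real_of_nat, where f = "\<lambda>_. 0"])
       (use q in \<open>auto simp: dist_padic_def less_imp_le\<close>)
  have "Cauchy (\<lambda>n. of_rat (q n) :: 'a padic)"
  proof (rule metric_CauchyI)
    fix e :: real assume e: "e > 0"
    obtain M where M: "\<forall>m\<ge>M. \<forall>n\<ge>M. dist (x m) (x n) < e / 3"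
      using x e unfolding Cauchy_def by (meson divide_pos_pos zero_less_numeral)
    obtain N where N: "\<forall>n\<ge>N. dist (x n) (of_rat (q n)) < e / 3"
      using order_tendstoD(2)[OF q0, of "e / 3"] e by (auto simp: eventually_sequentially)
    have "dist (of_rat (q m)) (of_rat (q n) :: 'a padic) < e" if "m \<ge> max M N" "n \<ge> max M N" for m n
      using M[rule_format, of m n] N[rule_format, of m] N[rule_format, of n] that
        dist_triangle[of "of_rat (q m)" "of_rat (q n)" "x m"]
        dist_triangle[of "x m" "of_rat (q n)" "x n"]
      by (simp add: dist_commute)
    thus "\<exists>M. \<forall>m\<ge>M. \<forall>n\<ge>M. dist (of_rat (q m)) (of_rat (q n) :: 'a padic) < e" by blast
  qed
  hence cq: "padic_cauchy CARD('a) q"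
    by (simp add: Cauchy_def padic_cauchy_def dist_padic_def padic_abs_of_rat flip: of_rat_diff)
  define Q :: "'a padic_seq" where "Q = Abs_padic_seq q"
  have Q: "Rep_padic_seq Q = q" using cq by (simp add: Q_def Abs_padic_seq_inverse)
  have "(\<lambda>n. dist (of_rat (q n)) (abs_padic Q)) \<longlonglongrightarrow> 0"
  proof (rule LIMSEQ_I)
    fix e :: real assume e: "e > 0"
    then obtain M where M: "\<forall>m\<ge>M. \<forall>n\<ge>M. rat_padic_abs CARD('a) (q m - q n) < e / 2"
      using cq unfolding padic_cauchy_def by (meson half_gt_zero)
    have "dist (of_rat (q m)) (abs_padic Q) < e" if m: "m \<ge> M" for m
    proof -
      have "padic_seq_abs (padic_seq_const (q m) - Q) \<le> e / 2"
        by (rule LIMSEQ_le_const2[OF padic_seq_abs_LIMSEQ])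
           (use M m in \<open>auto simp: minus_padic_seq.rep_eq padic_seq_const.rep_eq Q intro!: exI[of _ M] less_imp_le\<close>)
      thus ?thesis using e
        by (simp add: dist_padic_def padic_of_rat minus_padic.abs_eq padic_abs.abs_eq)
    qed
    thus "\<exists>M. \<forall>n\<ge>M. norm (dist (of_rat (q n)) (abs_padic Q) - 0) < e" by auto
  qed
  hence "(\<lambda>n. dist (x n) (of_rat (q n)) + dist (of_rat (q n)) (abs_padic Q)) \<longlonglongrightarrow> 0"
    using tendsto_add[OF q0] by fastforce
  hence "(\<lambda>n. dist (x n) (abs_padic Q)) \<longlonglongrightarrow> 0"
    by (rule tendsto_sandwich[where f = "\<lambda>_. 0", rotated 3]) (auto intro!: always_eventually dist_triangle)
  thus "convergent x" unfolding convergent_def using tendsto_dist_iff by blast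
qed


section \<open>Haar measure and the fractional Cesaro--Morrey norm\<close>

text \<open>
  Haar measurable sets are those of the completion of the Borel \<open>\<sigma>\<close>-algebra, so a Haar
  measure here is complete, like \<^const>\<open>lebesgue\<close> in contrast to \<^const>\<open>lborel\<close>.
  A translation invariant Borel measure giving the unit ball measure 1 is finite on compact
  sets and regular.
\<close>

definition normalized_haar :: "'p::prime_card padic measure \<Rightarrow> bool" where
  "normalized_haar M \<longleftrightarrow> (\<exists>B. M = completion B \<and> sets B = sets borel \<and>
     (\<forall>a. distr B B (\<lambda>x. a + x) = B) \<and> emeasure B {x. padic_abs x \<le> 1} = 1)"

definition padic_ball :: "int \<Rightarrow> 'p::prime_card padic \<Rightarrow> 'p padic set" where
  "padic_ball l a = {x. padic_abs (x - a) \<le> real CARD('p) powi l}"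

text \<open>Used only for positive exponents \<open>s\<close>, whence \<open>\<infinity>\<close> is sent to \<open>\<infinity>\<close>.\<close>

definition ennreal_powr :: "ennreal \<Rightarrow> real \<Rightarrow> ennreal" where
  "ennreal_powr x s = (if x = \<infinity> then \<infinity> else ennreal (enn2real x powr s))"

text \<open>
  At \<open>x = 0\<close> the divisor below is 0 because \<open>0 powr s = 0\<close>; this concerns only a set of measure 0.
\<close>

definition cesaro_morrey_norm ::
  "'p::prime_card padic measure \<Rightarrow> real \<Rightarrow> real \<Rightarrow> real \<Rightarrow> ('p padic \<Rightarrow> complex) \<Rightarrow> ennreal" where
  "cesaro_morrey_norm M \<beta> r q f =
     (SUP a. SUP l.
        ennreal (measure M (padic_ball l a) powr (1 / q - 1 / r)) *
        ennreal_powr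
          (\<integral>\<^sup>+x\<in>padic_ball l a.
             ennreal_powr
               ((\<integral>\<^sup>+t\<in>{t. padic_abs t \<le> padic_abs x}. ennreal (norm (f t)) \<partial>M)
                / ennreal (padic_abs x powr (1 - \<beta>))) r \<partial>M)
          (1 / r))"

end

theory Submission
  imports Defs
begin

text \<open>
  Restricted to one ball, the norm is a fixed constant times an \<open>L\<^sup>r\<close> norm of
  \<open>x \<mapsto> |x|\<^sup>\<beta>\<^sup>-\<^sup>1 \<integral> |f(t)| dt\<close> (over \<open>|t| \<le> |x|\<close>). This inner expression is linear
  in \<open>|f|\<close>, so by Tonelli it commutes with integration in the parameter \<open>y\<close>, also where it is
  infinite. Minkowski's integral inequality then moves the \<open>L\<^sup>r\<close> norm under the integral over
  \<open>y\<close>, which gives the estimate for each ball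
  (\<open>cesaro_morrey_local_nn_integral_le\<close>). The local quantity under that integral is
  at most the full norm of the section, and the resulting bound no longer depends on the ball,
  so the supremum over balls can be taken last. Working on one ball first keeps every function to
  which Tonelli is applied measurable; the full norm is a supremum over uncountably many balls.

  Minkowski's integral inequality (\<open>minkowski_nn_integral\<close>) comes from Jensen's
  inequality rather than from duality: if \<open>N(y)\<close> is the \<open>L\<^sup>r\<close> norm of \<open>h(y, \<cdot>)\<close> and
  \<open>S = \<integral> N\<close> is finite and positive, then \<open>(\<integral> h(y, x) dy) / S\<close> is the average of the
  normalised functions \<open>h(y, x) / N(y)\<close> for the probability density \<open>N / S\<close>. Jensen's
  inequality bounds its \<open>r\<close>-th power by the average of \<open>(h(y, x) / N(y))\<^sup>r\<close>, and each
  of these with \<open>N(y)\<close> positive and finite has integral 1 over \<open>x\<close>.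

  Two measure-theoretic points remain. Tonelli needs Haar measure to be \<open>\<sigma>\<close>-finite, which
  holds because the translates of the unit ball by rationals cover the space. And \<open>F\<close> is
  measurable only for the completed product, so \<open>|F|\<close> is replaced by an almost everywhere
  equal function that is measurable for the product itself; almost every section agrees almost
  everywhere, in either variable, and the norm does not see null sets.
\<close>

section \<open>Powers of extended nonnegative reals\<close>

lemma ennreal_mult_divide_cancel:
  fixes a b :: ennreal
  assumes "a \<noteq> 0" "a \<noteq> top_class.top"
  shows "a * (b / a) = b"
  using assms by (simp add: ennreal_times_divide mult.commute[of a] mult_divide_eq_ennreal)

lemma ennreal_powr_top [simp]: "ennreal_powr top_class.top s = top_class.top"
  by (simp_all add: ennreal_powr_def)

lemma ennreal_powr_ennreal: "0 \<le> x \<Longrightarrow> ennreal_powr (ennreal x) s = ennreal (x powr s)"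
  by (simp add: ennreal_powr_def)

lemma ennreal_powr_0 [simp]: "ennreal_powr 0 s = 0"
  by (simp add: ennreal_powr_def)

lemma ennreal_powr_1 [simp]: "ennreal_powr x 1 = x"
  by (cases x) (simp_all add: ennreal_powr_ennreal)

lemma ennreal_powr_eq_0_iff [simp]: "ennreal_powr x s = 0 \<longleftrightarrow> x = 0"
  by (cases x) (auto simp: ennreal_powr_ennreal)

lemma ennreal_powr_eq_top_iff [simp]: "ennreal_powr x s = top_class.top \<longleftrightarrow> x = top_class.top"
  by (cases x) (auto simp: ennreal_powr_ennreal)

lemma ennreal_powr_powr: "ennreal_powr (ennreal_powr x s) t = ennreal_powr x (s * t)"
  by (cases x) (simp_all add: ennreal_powr_ennreal powr_powr)

lemma ennreal_powr_mult:
  "ennreal_powr (x * y) s = ennreal_powr x s * ennreal_powr y s"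
proof (cases x; cases y)
  fix a b :: real
  assume "0 \<le> a" "x = ennreal a" "0 \<le> b" "y = ennreal b"
  then show ?thesis
    by (simp add: ennreal_powr_ennreal powr_mult flip: ennreal_mult)
qed (auto simp: ennreal_mult_top ennreal_top_mult ennreal_powr_ennreal)

lemma ennreal_powr_mono:
  assumes "x \<le> y" "0 \<le> s"
  shows "ennreal_powr x s \<le> ennreal_powr y s"
  using assms by (cases x; cases y) (auto simp: ennreal_powr_ennreal top_unique intro!: ennreal_leI powr_mono2)

lemma ennreal_powr_indicator:
  "ennreal_powr (x * indicator A a) s = ennreal_powr x s * indicator A a"
  by (simp add: indicator_def)

lemma measurable_ennreal_powr [measurable (raw)]:
  assumes [measurable]: "f \<in> borel_measurable M"
  shows "(\<lambda>x. ennreal_powr (f x) s) \<in> borel_measurable M"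
  unfolding ennreal_powr_def by measurable

section \<open>Jensen's and Minkowski's integral inequalities\<close>

text \<open>
  The convex function \<open>u\<^sup>r\<close> lies above its tangent at \<open>c\<close>; the subtracted constant is moved to
  the other side because there is no useful subtraction of extended reals. It is Young's
  inequality for \<open>u\<^sup>r\<close> and \<open>c\<^sup>r\<close> with weights \<open>1/r\<close> and \<open>1 - 1/r\<close>.
\<close>

lemma ennreal_powr_tangent_le:
  assumes r: "1 \<le> r" and c: "0 < c"
  shows "ennreal (r * c powr (r - 1)) * u \<le> ennreal_powr u r + ennreal ((r - 1) * c powr r)"
proof (cases u)
  case (real v)
  have "r * c powr (r - 1) * v \<le> v powr r + (r - 1) * c powr r"
  proof (cases "v = 0")
    case False
    then have v: "v > 0" using real by simp
    have "(v powr r) powr (1 / r) * (c powr r) powr (1 - 1 / r)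
        \<le> 1 / r * v powr r + (1 - 1 / r) * c powr r"
      using r c v by (intro Youngs_inequality_0) auto
    moreover have "r * (1 - 1 / r) = r - 1" using r by (simp add: field_simps)
    ultimately have "v * c powr (r - 1) \<le> 1 / r * v powr r + (1 - 1 / r) * c powr r"
      using r v by (simp add: powr_powr)
    then have "r * (v * c powr (r - 1)) \<le> r * (1 / r * v powr r + (1 - 1 / r) * c powr r)"
      using r by (intro mult_left_mono) auto
    also have "\<dots> = v powr r + (r - 1) * c powr r"
      using r by (simp add: field_simps)
    finally show ?thesis by (simp add: mult_ac)
  qed (use r in simp)
  then show ?thesis
    using real r by (simp add: ennreal_powr_ennreal flip: ennreal_mult ennreal_plus)
qed simp

text \<open>
  Jensen's inequality for \<open>u\<^sup>r\<close>: integrate the tangent inequality and take the point of tangency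
  to be the mean of \<open>u\<close>.
\<close>

lemma ennreal_powr_nn_integral_le:
  assumes P: "emeasure P (space P) = 1" and r: "1 \<le> r"
    and [measurable]: "u \<in> borel_measurable P"
  shows "ennreal_powr (\<integral>\<^sup>+x. u x \<partial>P) r \<le> (\<integral>\<^sup>+x. ennreal_powr (u x) r \<partial>P)"
    (is "ennreal_powr ?A r \<le> ?K")
proof (cases "?K = \<infinity> \<or> ?A = 0")
  case False
  have tangent: "ennreal (r * c powr (r - 1)) * ?A \<le> ?K + ennreal ((r - 1) * c powr r)"
    if "c > 0" for c
  proof -
    have "ennreal (r * c powr (r - 1)) * ?A = (\<integral>\<^sup>+x. ennreal (r * c powr (r - 1)) * u x \<partial>P)"
      by (simp add: nn_integral_cmult)
    also have "\<dots> \<le> (\<integral>\<^sup>+x. ennreal_powr (u x) r + ennreal ((r - 1) * c powr r) \<partial>P)"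
      by (intro nn_integral_mono ennreal_powr_tangent_le r that)
    also have "\<dots> = ?K + ennreal ((r - 1) * c powr r)"
      by (simp add: nn_integral_add P)
    finally show ?thesis .
  qed
  obtain k where k: "?K = ennreal k" "0 \<le> k" using False by (cases ?K) auto
  \<comment> \<open>An infinite mean is no point of tangency; the tangent at 1 already excludes it.\<close>
  have "?A \<noteq> \<infinity>"
    using tangent[of 1] r k by (auto simp: ennreal_mult_top top_unique)
  then obtain c where c: "?A = ennreal c" "0 \<le> c" by (cases ?A) auto
  then have "c > 0" using False by (cases "c = 0") auto
  from tangent[OF this] have "r * c powr (r - 1) * c \<le> k + (r - 1) * c powr r"
    using r k c by (simp flip: ennreal_mult ennreal_plus)
  moreover have "c powr (r - 1) * c = c powr r"
    using \<open>c > 0\<close> by (simp add: powr_diff)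
  ultimately have "r * c powr r \<le> k + (r - 1) * c powr r" by (simp add: mult.assoc)
  then have "c powr r \<le> k" by (simp add: left_diff_distrib)
  then show ?thesis using c k by (simp add: ennreal_powr_ennreal ennreal_leI)
qed auto

text \<open>
  Minkowski's integral inequality. With \<open>N(y)\<close> the \<open>L\<^sup>r\<close> norm of the section at \<open>y\<close> and \<open>S\<close> the
  integral of \<open>N\<close>, the integral over \<open>y\<close> is, up to the factor \<open>S\<close>, an average of normalised
  sections for the probability density \<open>N / S\<close>, so Jensen's inequality applies for almost every
  \<open>x\<close>, and Tonelli integrates the outcome over \<open>x\<close>.
\<close>

theorem (in pair_sigma_finite) minkowski_nn_integral:
  assumes r: "1 \<le> r" and h [measurable]: "case_prod h \<in> borel_measurable (M1 \<Otimes>\<^sub>M M2)"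
  shows "ennreal_powr (\<integral>\<^sup>+x. ennreal_powr (\<integral>\<^sup>+y. h y x \<partial>M1) r \<partial>M2) (1 / r)
    \<le> (\<integral>\<^sup>+y. ennreal_powr (\<integral>\<^sup>+x. ennreal_powr (h y x) r \<partial>M2) (1 / r) \<partial>M1)"
proof -
  define N where "N y = ennreal_powr (\<integral>\<^sup>+x. ennreal_powr (h y x) r \<partial>M2) (1 / r)" for y
  define S where "S = (\<integral>\<^sup>+y. N y \<partial>M1)"
  define H where "H x = (\<integral>\<^sup>+y. h y x \<partial>M1)" for x
  have N_measurable [measurable]: "N \<in> borel_measurable M1"
    unfolding N_def by measurable
  have H_measurable [measurable]: "H \<in> borel_measurable M2"
    unfolding H_def by measurable
  have N_powr: "ennreal_powr (N y) r = (\<integral>\<^sup>+x. ennreal_powr (h y x) r \<partial>M2)" for y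
    using r by (simp add: N_def ennreal_powr_powr)
  \<comment> \<open>Dividing by \<open>N y\<close> loses the sections of norm 0; for almost every \<open>x\<close> they contribute nothing.\<close>
  have null: "AE x in M2. AE y in M1. N y = 0 \<longrightarrow> h y x = 0"
  proof (subst AE_commute[symmetric])
    show "AE y in M1. AE x in M2. N y = 0 \<longrightarrow> h y x = 0"
    proof (rule AE_I2)
      fix y assume [simp]: "y \<in> space M1"
      have "AE x in M2. h y x = 0" if "N y = 0"
        using N_powr[of y] that by (simp add: nn_integral_0_iff_AE)
      then show "AE x in M2. N y = 0 \<longrightarrow> h y x = 0" by (cases "N y = 0") auto
    qed
  qed measurable
  have "(\<integral>\<^sup>+x. ennreal_powr (H x) r \<partial>M2) \<le> ennreal_powr S r"
  proof -
    consider "S = \<infinity>" | "S = 0" | "S \<noteq> 0" "S \<noteq> top_class.top" by auto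
    then show ?thesis
    proof cases
      case 1
      then show ?thesis by simp
    next
      case 2
      then have N0: "AE y in M1. N y = 0"
        by (simp add: S_def nn_integral_0_iff_AE)
      have "AE x in M2. H x = 0"
        using null
      proof eventually_elim
        case (elim x)
        with N0 have "AE y in M1. h y x = 0" by eventually_elim auto
        then have "(\<integral>\<^sup>+y. h y x \<partial>M1) = (\<integral>\<^sup>+y. 0 \<partial>M1)" by (rule nn_integral_cong_AE)
        then show ?case by (simp add: H_def)
      qed
      then have "(\<integral>\<^sup>+x. ennreal_powr (H x) r \<partial>M2) = (\<integral>\<^sup>+x. 0 \<partial>M2)"
        by (intro nn_integral_cong_AE) auto
      then show ?thesis by simp
    next
      case 3
      note S = this
      have N_finite: "AE y in M1. N y \<noteq> top_class.top"
        using nn_integral_PInf_AE[of N M1] S by (simp add: S_def)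
      define P where "P = density M1 (\<lambda>y. N y / S)"
      have P: "emeasure P (space P) = 1"
      proof -
        have "emeasure P (space P) = (\<integral>\<^sup>+y. N y / S \<partial>M1)"
          by (simp add: P_def emeasure_density cong: nn_integral_cong)
        also have "\<dots> = 1"
          using S by (simp add: nn_integral_divide ennreal_divide_self less_top flip: S_def)
        finally show ?thesis .
      qed
      have jensen: "AE x in M2. ennreal_powr (H x / S) r
          \<le> (\<integral>\<^sup>+y. N y / S * ennreal_powr (h y x / N y) r \<partial>M1)"
        using null AE_space
      proof eventually_elim
        case (elim x)
        have [measurable]: "(\<lambda>y. h y x) \<in> borel_measurable M1" using elim(2) by measurable
        have "H x / S = (\<integral>\<^sup>+y. h y x / S \<partial>M1)"
          by (simp add: H_def nn_integral_divide)
        also have "\<dots> = (\<integral>\<^sup>+y. N y / S * (h y x / N y) \<partial>M1)"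
          using elim(1) N_finite
        proof (intro nn_integral_cong_AE, eventually_elim)
          case (elim y)
          show ?case
          proof (cases "N y = 0")
            case False
            have "N y / S * (h y x / N y) = N y * (h y x / N y) / S"
              by (simp add: divide_ennreal_def mult_ac)
            also have "\<dots> = h y x / S"
              using False elim by (simp add: ennreal_mult_divide_cancel)
            finally show ?thesis by simp
          qed (use elim in simp)
        qed
        also have "\<dots> = (\<integral>\<^sup>+y. h y x / N y \<partial>P)"
          unfolding P_def by (subst nn_integral_density) auto
        finally have "ennreal_powr (H x / S) r \<le> (\<integral>\<^sup>+y. ennreal_powr (h y x / N y) r \<partial>P)"
          using ennreal_powr_nn_integral_le[OF P r, of "\<lambda>y. h y x / N y"] by (simp add: P_def)
        also have "\<dots> = (\<integral>\<^sup>+y. N y / S * ennreal_powr (h y x / N y) r \<partial>M1)"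
          unfolding P_def by (subst nn_integral_density) auto
        finally show ?case .
      qed
      have normalised: "N y / S * (\<integral>\<^sup>+x. ennreal_powr (h y x / N y) r \<partial>M2) \<le> N y / S"
        if "N y \<noteq> top_class.top" "y \<in> space M1" for y
      proof (cases "N y = 0")
        case False
        have [measurable]: "(\<lambda>x. h y x) \<in> borel_measurable M2" using that(2) by measurable
        have "ennreal_powr (N y) r * (\<integral>\<^sup>+x. ennreal_powr (h y x / N y) r \<partial>M2)
            = (\<integral>\<^sup>+x. ennreal_powr (N y * (h y x / N y)) r \<partial>M2)"
          by (simp add: nn_integral_cmult ennreal_powr_mult)
        also have "\<dots> = ennreal_powr (N y) r * 1"
          using False that by (simp add: N_powr ennreal_mult_divide_cancel)
        finally have "(\<integral>\<^sup>+x. ennreal_powr (h y x / N y) r \<partial>M2) = 1"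
          using False that by (subst (asm) ennreal_mult_cancel_left) auto
        then show ?thesis by simp
      qed simp
      have "(\<integral>\<^sup>+x. ennreal_powr (H x / S) r \<partial>M2)
          \<le> (\<integral>\<^sup>+x. (\<integral>\<^sup>+y. N y / S * ennreal_powr (h y x / N y) r \<partial>M1) \<partial>M2)"
        by (rule nn_integral_mono_AE[OF jensen])
      also have "\<dots> = (\<integral>\<^sup>+y. (\<integral>\<^sup>+x. N y / S * ennreal_powr (h y x / N y) r \<partial>M2) \<partial>M1)"
        by (rule Fubini') measurable
      also have "\<dots> = (\<integral>\<^sup>+y. N y / S * (\<integral>\<^sup>+x. ennreal_powr (h y x / N y) r \<partial>M2) \<partial>M1)"
        by (intro nn_integral_cong nn_integral_cmult) measurable
      also have "\<dots> \<le> (\<integral>\<^sup>+y. N y / S \<partial>M1)"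
      proof (rule nn_integral_mono_AE)
        show "AE y in M1. N y / S * (\<integral>\<^sup>+x. ennreal_powr (h y x / N y) r \<partial>M2) \<le> N y / S"
          using N_finite AE_space by eventually_elim (rule normalised)
      qed
      also have "\<dots> = 1"
        using S by (simp add: nn_integral_divide ennreal_divide_self less_top flip: S_def)
      finally have "(\<integral>\<^sup>+x. ennreal_powr (H x / S) r \<partial>M2) \<le> 1" .
      then have "ennreal_powr S r * (\<integral>\<^sup>+x. ennreal_powr (H x / S) r \<partial>M2) \<le> ennreal_powr S r * 1"
        by (rule mult_left_mono) simp
      also have "ennreal_powr S r * (\<integral>\<^sup>+x. ennreal_powr (H x / S) r \<partial>M2)
          = (\<integral>\<^sup>+x. ennreal_powr (S * (H x / S)) r \<partial>M2)"
        by (simp add: nn_integral_cmult ennreal_powr_mult)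
      also have "\<dots> = (\<integral>\<^sup>+x. ennreal_powr (H x) r \<partial>M2)"
        using S by (simp add: ennreal_mult_divide_cancel)
      finally show ?thesis by simp
    qed
  qed
  then have "ennreal_powr (\<integral>\<^sup>+x. ennreal_powr (H x) r \<partial>M2) (1 / r)
      \<le> ennreal_powr (ennreal_powr S r) (1 / r)"
    using r by (intro ennreal_powr_mono) auto
  also have "\<dots> = S"
    using r by (simp add: ennreal_powr_powr)
  finally show ?thesis unfolding H_def S_def N_def .
qed

section \<open>Haar measure\<close>

lemma borel_measurable_padic_abs_diff:
  "(\<lambda>x. padic_abs (x - a)) \<in> borel_measurable (borel :: 'p::prime_card padic measure)"
proof -
  have "continuous_on UNIV (\<lambda>x. dist x a)" by (intro continuous_intros)
  then show ?thesis
    unfolding dist_padic_def by (rule borel_measurable_continuous_onI)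
qed

lemma borel_measurable_padic_translation:
  "(\<lambda>x. a + x) \<in> borel_measurable (borel :: 'p::prime_card padic measure)"
proof (rule borel_measurable_continuous_onI)
  show "continuous_on UNIV (\<lambda>x. a + x :: 'p padic)"
    unfolding continuous_on_iff dist_padic_def by auto
qed

lemma space_normalized_haar:
  assumes "normalized_haar M"
  shows "space M = UNIV"
  using assms unfolding normalized_haar_def by (auto dest: sets_eq_imp_space_eq)

lemma normalized_haar_padic_abs_measurable:
  assumes "normalized_haar M"
  shows "(\<lambda>x. padic_abs (x - a)) \<in> borel_measurable M"
proof -
  obtain B where B: "M = completion B" "sets B = sets borel"
    using assms unfolding normalized_haar_def by blast
  have "(\<lambda>x. padic_abs (x - a)) \<in> borel_measurable B"
    using borel_measurable_padic_abs_diff[of a] measurable_cong_sets[OF B(2) refl] by blast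
  then show ?thesis unfolding B(1) by (rule measurable_completion)
qed

lemma padic_ball_sets:
  assumes "normalized_haar M"
  shows "padic_ball l a \<in> sets M"
proof -
  note [measurable] = normalized_haar_padic_abs_measurable[OF assms, of a]
  have "{x \<in> space M. padic_abs (x - a) \<le> real CARD('a) powi l} \<in> sets M" by measurable
  then show ?thesis by (simp add: padic_ball_def space_normalized_haar[OF assms])
qed

text \<open>
  The rationals are dense, so the balls of radius 1 around them cover the space; by translation
  invariance each has measure 1.
\<close>

lemma sigma_finite_normalized_haar:
  assumes M: "normalized_haar M"
  shows "sigma_finite_measure M"
proof
  let ?U = "\<lambda>q. padic_ball 0 (of_rat q) :: 'a padic set"
  obtain B where B: "M = completion B" "sets B = sets borel"
    "\<And>a. distr B B (\<lambda>x. a + x) = B" "emeasure B {x. padic_abs x \<le> 1} = 1"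
    using M unfolding normalized_haar_def by blast
  have space: "space B = UNIV" using sets_eq_imp_space_eq[OF B(2)] by simp
  have ball: "?U q \<in> sets B" for q
  proof -
    have "(\<lambda>x. padic_abs (x - of_rat q)) -` {..1} \<inter> space borel \<in> sets (borel :: 'a padic measure)"
      by (rule measurable_sets[OF borel_measurable_padic_abs_diff]) simp
    then show ?thesis by (simp add: B(2) padic_ball_def vimage_def)
  qed
  have unit: "emeasure B (?U q) = 1" for q
  proof -
    have "emeasure B (?U q) = emeasure (distr B B (\<lambda>x. of_rat q + x)) (?U q)"
      by (simp add: B(3))
    also have "\<dots> = emeasure B ((\<lambda>x. of_rat q + x) -` ?U q \<inter> space B)"
      using borel_measurable_padic_translation[of "of_rat q"] ball
      by (intro emeasure_distr) (simp_all add: measurable_cong_sets[OF B(2) B(2)])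
    also have "(\<lambda>x. of_rat q + x) -` ?U q \<inter> space B = {x. padic_abs x \<le> 1}"
      by (auto simp: padic_ball_def space)
    finally show ?thesis using B(4) by simp
  qed
  have "(\<Union>q. ?U q) = UNIV"
  proof (intro equalityI subsetI)
    fix x :: "'a padic"
    obtain q where "padic_abs (x - of_rat q) < 1" using padic_rat_dense[of 1 x] by auto
    then show "x \<in> (\<Union>q. ?U q)" by (auto simp: padic_ball_def intro!: less_imp_le)
  qed simp
  moreover have "range ?U \<subseteq> sets M"
    using padic_ball_sets[OF M] by auto
  moreover have "emeasure M (?U q) = 1" for q
    using unit[of q] ball[of q] by (simp add: B(1))
  ultimately show "\<exists>A. countable A \<and> A \<subseteq> sets M \<and> \<Union> A = space M \<and> (\<forall>a\<in>A. emeasure M a \<noteq> \<infinity>)"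
    by (intro exI[of _ "range ?U"]) (auto simp: space_normalized_haar[OF M])
qed

section \<open>The norm on a single ball\<close>

definition cesaro_mean ::
  "'p::prime_card padic measure \<Rightarrow> real \<Rightarrow> ('p padic \<Rightarrow> ennreal) \<Rightarrow> 'p padic \<Rightarrow> ennreal" where
  "cesaro_mean M \<beta> g x =
     (\<integral>\<^sup>+t\<in>{t. padic_abs t \<le> padic_abs x}. g t \<partial>M) / ennreal (padic_abs x powr (1 - \<beta>))"

text \<open>
  The argument is the absolute value of a function, with values in the extended nonnegative reals:
  the integral over \<open>y\<close> of \<open>|F(y, t)|\<close>, which dominates the absolute value of the integral of
  \<open>F(y, t)\<close>, may be infinite for some \<open>t\<close>.
\<close>

definition cesaro_morrey_local ::
  "'p::prime_card padic measure \<Rightarrow> real \<Rightarrow> real \<Rightarrow> real \<Rightarrow> 'p padic \<Rightarrow> int \<Rightarrow> ('p padic \<Rightarrow> ennreal) \<Rightarrow> ennreal"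
  where
  "cesaro_morrey_local M \<beta> r q a l g =
     ennreal (measure M (padic_ball l a) powr (1 / q - 1 / r)) *
     ennreal_powr (\<integral>\<^sup>+x\<in>padic_ball l a. ennreal_powr (cesaro_mean M \<beta> g x) r \<partial>M) (1 / r)"

lemma cesaro_morrey_norm_eq_SUP_local:
  "cesaro_morrey_norm M \<beta> r q f = (SUP a. SUP l. cesaro_morrey_local M \<beta> r q a l (\<lambda>t. ennreal (norm (f t))))"
  by (simp add: cesaro_morrey_norm_def cesaro_morrey_local_def cesaro_mean_def)

lemma cesaro_morrey_local_le_norm:
  "cesaro_morrey_local M \<beta> r q a l (\<lambda>t. ennreal (norm (f t))) \<le> cesaro_morrey_norm M \<beta> r q f"
  unfolding cesaro_morrey_norm_eq_SUP_local by (intro SUP_upper2[of a] SUP_upper2[of l]) auto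

lemma cesaro_mean_mono_AE:
  assumes "AE t in M. g t \<le> g' t"
  shows "cesaro_mean M \<beta> g x \<le> cesaro_mean M \<beta> g' x"
  unfolding cesaro_mean_def
proof (intro divide_right_mono_ennreal nn_integral_mono_AE)
  show "AE t in M. g t * indicator {t. padic_abs t \<le> padic_abs x} t
      \<le> g' t * indicator {t. padic_abs t \<le> padic_abs x} t"
    using assms by eventually_elim (rule mult_right_mono, auto)
qed

lemma cesaro_morrey_local_mono_AE:
  assumes "AE t in M. g t \<le> g' t" and "0 < r"
  shows "cesaro_morrey_local M \<beta> r q a l g \<le> cesaro_morrey_local M \<beta> r q a l g'"
  unfolding cesaro_morrey_local_def using assms(2)
  by (intro mult_left_mono mult_right_mono ennreal_powr_mono nn_integral_mono
      cesaro_mean_mono_AE[OF assms(1)]) auto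

text \<open>
  Tonelli's theorem over the ball \<open>|t| \<le> |x|\<close>. The division commutes with the integral even at
  \<open>x = 0\<close>, where the divisor is 0, since it is multiplication by an extended constant.
\<close>

lemma cesaro_mean_nn_integral:
  fixes M :: "'p::prime_card padic measure"
  assumes M: "normalized_haar M" and g [measurable]: "case_prod g \<in> borel_measurable (M \<Otimes>\<^sub>M M)"
  shows "cesaro_mean M \<beta> (\<lambda>t. \<integral>\<^sup>+y. g y t \<partial>M) x = (\<integral>\<^sup>+y. cesaro_mean M \<beta> (g y) x \<partial>M)"
    and "(\<lambda>(y, x). cesaro_mean M \<beta> (g y) x) \<in> borel_measurable (M \<Otimes>\<^sub>M M)"
proof -
  interpret sigma_finite_measure M by (rule sigma_finite_normalized_haar[OF M])
  interpret pair_sigma_finite M M ..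
  have [measurable]: "padic_abs \<in> borel_measurable M"
    using normalized_haar_padic_abs_measurable[OF M, of 0] by simp
  show "(\<lambda>(y, x). cesaro_mean M \<beta> (g y) x) \<in> borel_measurable (M \<Otimes>\<^sub>M M)"
    unfolding cesaro_mean_def indicator_def by measurable
  show "cesaro_mean M \<beta> (\<lambda>t. \<integral>\<^sup>+y. g y t \<partial>M) x = (\<integral>\<^sup>+y. cesaro_mean M \<beta> (g y) x \<partial>M)"
  proof -
    let ?D = "{t. padic_abs t \<le> padic_abs x}"
    have "(\<integral>\<^sup>+t\<in>?D. (\<integral>\<^sup>+y. g y t \<partial>M) \<partial>M) = (\<integral>\<^sup>+t. (\<integral>\<^sup>+y. g y t * indicator ?D t \<partial>M) \<partial>M)"
      by (intro nn_integral_cong nn_integral_multc[symmetric]) measurable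
    also have "\<dots> = (\<integral>\<^sup>+y. (\<integral>\<^sup>+t\<in>?D. g y t \<partial>M) \<partial>M)"
      unfolding indicator_def by (rule Fubini') measurable
    finally show ?thesis
      unfolding cesaro_mean_def indicator_def by (subst nn_integral_divide) auto
  qed
qed

lemma cesaro_morrey_local_nn_integral_le:
  fixes M :: "'p::prime_card padic measure"
  assumes M: "normalized_haar M" and r: "1 \<le> r"
    and g: "case_prod g \<in> borel_measurable (M \<Otimes>\<^sub>M M)"
  shows "cesaro_morrey_local M \<beta> r q a l (\<lambda>t. \<integral>\<^sup>+y. g y t \<partial>M)
    \<le> (\<integral>\<^sup>+y. cesaro_morrey_local M \<beta> r q a l (g y) \<partial>M)"
proof -
  interpret sigma_finite_measure M by (rule sigma_finite_normalized_haar[OF M])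
  interpret pair_sigma_finite M M ..
  note [measurable] = padic_ball_sets[OF M, of l a] cesaro_mean_nn_integral(2)[OF M g]
  let ?B = "padic_ball l a" and ?c = "ennreal (measure M (padic_ball l a) powr (1 / q - 1 / r))"
  \<comment> \<open>The cutoff to the ball goes inside the power, so that Minkowski applies on the whole space.\<close>
  define h where "h y x = cesaro_mean M \<beta> (g y) x * indicator ?B x" for y x
  have h [measurable]: "case_prod h \<in> borel_measurable (M \<Otimes>\<^sub>M M)"
    unfolding h_def by measurable
  have local_eq: "cesaro_morrey_local M \<beta> r q a l (g y)
      = ?c * ennreal_powr (\<integral>\<^sup>+x. ennreal_powr (h y x) r \<partial>M) (1 / r)" for y
    by (simp add: cesaro_morrey_local_def h_def ennreal_powr_indicator)
  have "cesaro_mean M \<beta> (\<lambda>t. \<integral>\<^sup>+y. g y t \<partial>M) x * indicator ?B x = (\<integral>\<^sup>+y. h y x \<partial>M)"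
    if "x \<in> space M" for x
    using that unfolding h_def cesaro_mean_nn_integral(1)[OF M g] by (simp add: nn_integral_multc)
  then have "cesaro_morrey_local M \<beta> r q a l (\<lambda>t. \<integral>\<^sup>+y. g y t \<partial>M)
      = ?c * ennreal_powr (\<integral>\<^sup>+x. ennreal_powr (\<integral>\<^sup>+y. h y x \<partial>M) r \<partial>M) (1 / r)"
    unfolding cesaro_morrey_local_def ennreal_powr_indicator[symmetric]
    by (simp cong: nn_integral_cong)
  also have "\<dots> \<le> ?c * (\<integral>\<^sup>+y. ennreal_powr (\<integral>\<^sup>+x. ennreal_powr (h y x) r \<partial>M) (1 / r) \<partial>M)"
    by (intro mult_left_mono minkowski_nn_integral r h) simp
  also have "\<dots> = (\<integral>\<^sup>+y. cesaro_morrey_local M \<beta> r q a l (g y) \<partial>M)"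
    unfolding local_eq by (rule nn_integral_cmult[symmetric]) measurable
  finally show ?thesis .
qed

section \<open>The norm of an integral of functions\<close>

text \<open>
  A function that is not integrable has integral 0 by convention, so the bound extends to it.
\<close>

lemma norm_lebesgue_integral_le_nn_integral:
  fixes f :: "'a \<Rightarrow> 'b::{banach, second_countable_topology}"
  shows "ennreal (norm (\<integral>x. f x \<partial>M)) \<le> (\<integral>\<^sup>+x. ennreal (norm (f x)) \<partial>M)"
  by (cases "integrable M f") (auto simp: not_integrable_integral_eq intro: integral_norm_bound_ennreal)

theorem lemma13:
  fixes M :: "'p::prime_card padic measure"
    and F :: "'p padic \<times> 'p padic \<Rightarrow> complex"
    and r q \<beta> :: real
  assumes "normalized_haar M"
    and "1 \<le> r" and "r \<le> q" and "0 \<le> \<beta>" and "\<beta> < 1"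
    and "F \<in> borel_measurable (completion (M \<Otimes>\<^sub>M M))"
    and "(\<integral>\<^sup>+y. cesaro_morrey_norm M \<beta> r q (\<lambda>t. F (y, t)) \<partial>M) < \<infinity>"
  shows "cesaro_morrey_norm M \<beta> r q (\<lambda>t. \<integral>y. F (y, t) \<partial>M)
           \<le> (\<integral>\<^sup>+y. cesaro_morrey_norm M \<beta> r q (\<lambda>t. F (y, t)) \<partial>M)"
proof -
  note M = assms(1) and r = assms(2)
  interpret sigma_finite_measure M by (rule sigma_finite_normalized_haar[OF M])
  interpret pair_sigma_finite M M ..
  have "(\<lambda>z. ennreal (norm (F z))) \<in> borel_measurable (completion (M \<Otimes>\<^sub>M M))"
    using assms(6) by measurable
  then obtain g' where [measurable]: "g' \<in> borel_measurable (M \<Otimes>\<^sub>M M)"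
    and F_g': "AE z in M \<Otimes>\<^sub>M M. ennreal (norm (F z)) = g' z"
    using completion_ex_borel_measurable by blast
  define g where "g y t = g' (y, t)" for y t
  have g: "case_prod g \<in> borel_measurable (M \<Otimes>\<^sub>M M)"
    unfolding g_def by simp
  have sections_y: "AE y in M. AE t in M. g y t = ennreal (norm (F (y, t)))"
    using AE_pair[OF F_g'] by (simp add: g_def eq_commute)
  have sections_t: "AE t in M. AE y in M. ennreal (norm (F (y, t))) = g y t"
  proof -
    have "AE z in M \<Otimes>\<^sub>M M. (case z of (t, y) \<Rightarrow> ennreal (norm (F (y, t))) = g' (y, t))"
      using F_g' by (subst (asm) distr_pair_swap) (auto dest!: AE_distrD[rotated] simp: split_beta')
    from AE_pair[OF this] show ?thesis by (simp add: g_def)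
  qed
  have integral_le: "AE t in M. ennreal (norm (\<integral>y. F (y, t) \<partial>M)) \<le> (\<integral>\<^sup>+y. g y t \<partial>M)"
    using sections_t
  proof eventually_elim
    case (elim t)
    have "ennreal (norm (\<integral>y. F (y, t) \<partial>M)) \<le> (\<integral>\<^sup>+y. ennreal (norm (F (y, t))) \<partial>M)"
      by (rule norm_lebesgue_integral_le_nn_integral)
    also have "\<dots> = (\<integral>\<^sup>+y. g y t \<partial>M)"
      by (rule nn_integral_cong_AE[OF elim])
    finally show ?case .
  qed
  have "cesaro_morrey_local M \<beta> r q a l (\<lambda>t. ennreal (norm (\<integral>y. F (y, t) \<partial>M)))
      \<le> (\<integral>\<^sup>+y. cesaro_morrey_norm M \<beta> r q (\<lambda>t. F (y, t)) \<partial>M)" for a l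
  proof -
    have "cesaro_morrey_local M \<beta> r q a l (\<lambda>t. ennreal (norm (\<integral>y. F (y, t) \<partial>M)))
        \<le> cesaro_morrey_local M \<beta> r q a l (\<lambda>t. \<integral>\<^sup>+y. g y t \<partial>M)"
      using r by (intro cesaro_morrey_local_mono_AE integral_le) simp
    also have "\<dots> \<le> (\<integral>\<^sup>+y. cesaro_morrey_local M \<beta> r q a l (g y) \<partial>M)"
      by (rule cesaro_morrey_local_nn_integral_le[OF M r g])
    also have "\<dots> \<le> (\<integral>\<^sup>+y. cesaro_morrey_norm M \<beta> r q (\<lambda>t. F (y, t)) \<partial>M)"
    proof (rule nn_integral_mono_AE)
      show "AE y in M. cesaro_morrey_local M \<beta> r q a l (g y) \<le> cesaro_morrey_norm M \<beta> r q (\<lambda>t. F (y, t))"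
        using sections_y
      proof eventually_elim
        case (elim y)
        then have "AE t in M. g y t \<le> ennreal (norm (F (y, t)))" by eventually_elim simp
        then show ?case
          using r by (intro order_trans[OF cesaro_morrey_local_mono_AE cesaro_morrey_local_le_norm]) simp_all
      qed
    qed
    finally show ?thesis .
  qed
  then show ?thesis
    unfolding cesaro_morrey_norm_eq_SUP_local[of M \<beta> r q "\<lambda>t. \<integral>y. F (y, t) \<partial>M"]
    by (intro SUP_least)
qed

end
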